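(* Let $G$ and $H$ be finite simple graphs with subsets $B_G\subseteq V(G)$ and $B_H\subseteq V(H)$, and let $f:G\to H$ be a surjective graph homomorphism such that $f(B_G)=B_H$. Then $$\zeta_G(B_G)\ge \zeta_H(B_H).$$
   Context: A graph homomorphism $f:G\to H$ is a map $f:V(G)\to V(H)$ such that $uv\in E(G)$ implies $f(u)f(v)\in E(H)$; it is surjective if it maps onto all of $V(H)$. For a finite simple graph $G$ and a subset $B\subseteq V(G)$, the $B$-restricted clique polynomial is $C_B(G;x)=\sum_{i=0}^{\omega(G[B])} c_i(B)x^i$, where $c_i(B)$ is the number of subsets $K\subseteq B$ with $|K|=i$ that are cliques in $G$; the empty set counts as a clique, so $c_0(B)=1$. Let $Z_B(G)=\{x<0 : C_B(G;x)=0\}$ (real $x$). If $Z_B(G)\neq\emptyset$, define $\zeta_G(B)=\max Z_B(G)$, the largest negative root of $C_B(G;x)$; if $Z_B(G)=\emptyset$, set $\zeta_G(B)=-\infty$. *)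

theory Defs
  imports
    "HOL-Library.Ramsey"
    "HOL-Library.Extended_Real"
    "HOL-Computational_Algebra.Polynomial"
begin

text \<open>
  A graph is a vertex set with a set of two-element subsets of it, the representation used by
  \<open>clique\<close> in \<open>HOL-Library.Ramsey\<close>. Note that \<open>clique K E\<close> does not say where the elements
  of \<open>K\<close> live, so \<open>K \<subseteq> B\<close> is always required separately below.
\<close>

locale fin_simple_graph =
  fixes V :: "'a set" and E :: "'a set set"
  assumes finite_verts: "finite V"
    and edges: "E \<subseteq> [V]\<^bsup>2\<^esup>"

definition graph_hom ::
    "'a set \<Rightarrow> 'a set set \<Rightarrow> 'b set \<Rightarrow> 'b set set \<Rightarrow> ('a \<Rightarrow> 'b) \<Rightarrow> bool" where
  "graph_hom V E W F f \<longleftrightarrow>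
     f \<in> V \<rightarrow> W \<and> (\<forall>u\<in>V. \<forall>v\<in>V. {u, v} \<in> E \<longrightarrow> {f u, f v} \<in> F)"

definition surj_graph_hom ::
    "'a set \<Rightarrow> 'a set set \<Rightarrow> 'b set \<Rightarrow> 'b set set \<Rightarrow> ('a \<Rightarrow> 'b) \<Rightarrow> bool" where
  "surj_graph_hom V E W F f \<longleftrightarrow> graph_hom V E W F f \<and> f ` V = W"

definition induced_edges :: "'a set set \<Rightarrow> 'a set \<Rightarrow> 'a set set" where
  "induced_edges E B = {e \<in> E. e \<subseteq> B}"

definition clique_number :: "'a set \<Rightarrow> 'a set set \<Rightarrow> nat" where
  "clique_number V E = Max {card K | K. K \<subseteq> V \<and> clique K E}"

definition num_cliques :: "'a set set \<Rightarrow> 'a set \<Rightarrow> nat \<Rightarrow> nat" where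
  "num_cliques E B i = card {K. K \<subseteq> B \<and> card K = i \<and> clique K E}"

text \<open>
  The vertex set of the graph does not occur in the next three definitions, because they depend
  only on the edge set and on \<open>B\<close>.
\<close>

definition clique_poly :: "'a set set \<Rightarrow> 'a set \<Rightarrow> real poly" where
  "clique_poly E B =
     (\<Sum>i = 0..clique_number B (induced_edges E B). monom (real (num_cliques E B i)) i)"

definition neg_roots :: "'a set set \<Rightarrow> 'a set \<Rightarrow> real set" where
  "neg_roots E B = {x. x < 0 \<and> poly (clique_poly E B) x = 0}"

definition zeta :: "'a set set \<Rightarrow> 'a set \<Rightarrow> ereal" where
  "zeta E B = (if neg_roots E B = {} then -\<infinity> else ereal (Max (neg_roots E B)))"

lemma num_cliques_0:
  assumes "finite B"
  shows "num_cliques E B 0 = 1"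
proof -
  have "{K. K \<subseteq> B \<and> card K = 0 \<and> clique K E} = {{}}"
    using assms by (auto simp: card_eq_0_iff dest: finite_subset)
  then show ?thesis by (simp add: num_cliques_def)
qed

lemma coeff_0_clique_poly:
  assumes "finite B"
  shows "coeff (clique_poly E B) 0 = 1"
  using assms by (simp add: clique_poly_def coeff_sum num_cliques_0)

text \<open>Hence the maximum in the definition of \<open>zeta\<close> is taken over a finite set.\<close>

lemma finite_neg_roots:
  assumes "finite B"
  shows "finite (neg_roots E B)"
proof -
  have "clique_poly E B \<noteq> 0"
    using coeff_0_clique_poly[OF assms, of E] by auto
  then have "finite {x. poly (clique_poly E B) x = 0}"
    by (rule poly_roots_finite)
  then show ?thesis
    by (rule rev_finite_subset) (auto simp: neg_roots_def)
qed

end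

theory Submission
  imports Defs
begin

text \<open>
  Both the inclusion of an induced subgraph and the deletion of edges are controlled by positivity:
  if the clique polynomial of a graph is positive on \<open>[-t, 0]\<close>, then so are those of its
  induced subgraphs (look at the first root of a vertex-deleted subgraph and use the recurrence
  \<open>C\<^sub>B = C\<^bsub>B - v\<^esub> + x C\<^bsub>N(v)\<^esub>\<close>) and those of the graphs obtained by adding edges (an added edge
  \<open>uv\<close> contributes \<open>x\<^sup>2 C\<^bsub>N(u) \<inter> N(v)\<^esub>\<close>). A section of \<open>f\<close> identifies an induced
  subgraph of \<open>G\<close> with a spanning subgraph of \<open>H\<close>, so a root of \<open>H\<close> at \<open>-t\<close> forces a
  root of \<open>G\<close> in \<open>[-t, 0)\<close>.
\<close>

section \<open>Clique polynomials as sums over cliques\<close>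

definition cliques :: "'a set set \<Rightarrow> 'a set \<Rightarrow> 'a set set" where
  "cliques E B = {K. K \<subseteq> B \<and> clique K E}"

definition clique_sum :: "'a set set \<Rightarrow> 'a set \<Rightarrow> real \<Rightarrow> real" where
  "clique_sum E B x = (\<Sum>K\<in>cliques E B. x ^ card K)"

lemma finite_cliques: "finite B \<Longrightarrow> finite (cliques E B)"
  by (simp add: cliques_def)

lemma poly_clique_poly:
  assumes "finite B"
  shows "poly (clique_poly E B) x = clique_sum E B x"
proof -
  let ?\<omega> = "clique_number B (induced_edges E B)"
  \<comment> \<open>For subsets of \<open>B\<close>, being a clique in the induced graph or in
    \<open>E\<close> is the same. So the degree bound covers every clique size and grouping by size
    loses nothing.\<close>
  have "{card K | K. K \<subseteq> B \<and> clique K (induced_edges E B)} = card ` cliques E B"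
    by (fastforce simp: cliques_def clique_def induced_edges_def)
  then have le: "card ` cliques E B \<subseteq> {0..?\<omega>}"
    using finite_cliques[OF assms, of E] by (auto simp: clique_number_def)
  have "poly (clique_poly E B) x = (\<Sum>i\<in>{0..?\<omega>}. real (num_cliques E B i) * x ^ i)"
    by (simp add: clique_poly_def poly_sum poly_monom)
  also have "\<dots> = (\<Sum>i\<in>{0..?\<omega>}. \<Sum>K | K \<in> cliques E B \<and> card K = i. x ^ card K)"
    by (intro sum.cong refl)
      (simp add: num_cliques_def cliques_def conj_commute conj_left_commute)
  also have "\<dots> = clique_sum E B x"
    unfolding clique_sum_def by (rule sum.group[OF finite_cliques[OF assms] _ le]) simp
  finally show ?thesis .
qed

lemma continuous_on_clique_sum: "continuous_on S (clique_sum E B)"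
  unfolding clique_sum_def by (intro continuous_intros)

lemma clique_sum_0: "finite B \<Longrightarrow> clique_sum E B 0 = 1"
  using poly_clique_poly[of B E 0] coeff_0_clique_poly[of B E] by (simp add: poly_0_coeff_0)

section \<open>Vertex and edge recurrences, invariance under isomorphism\<close>

lemma clique_sum_remove_vertex:
  assumes "finite B" "v \<in> B"
  shows "clique_sum E B x =
    clique_sum E (B - {v}) x + x * clique_sum E {w \<in> B - {v}. {v, w} \<in> E} x"
proof -
  let ?N = "{w \<in> B - {v}. {v, w} \<in> E}"
  have split: "cliques E B = cliques E (B - {v}) \<union> insert v ` cliques E ?N" (is "_ = ?A \<union> ?C")
  proof (intro equalityI subsetI)
    fix K assume K: "K \<in> cliques E B"
    show "K \<in> ?A \<union> ?C"
    proof (cases "v \<in> K")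
      case True
      then have "K - {v} \<in> cliques E ?N" "K = insert v (K - {v})"
        using K by (auto simp: cliques_def clique_def)
      then show ?thesis by blast
    qed (use K in \<open>auto simp: cliques_def\<close>)
  next
    fix K assume "K \<in> ?A \<union> ?C"
    then show "K \<in> cliques E B"
      using assms by (auto simp: cliques_def clique_def insert_commute)
  qed
  have inj: "inj_on (insert v) (cliques E ?N)"
    by (rule inj_onI) (auto simp: cliques_def insert_ident)
  have card: "card (insert v K) = Suc (card K)" if "K \<in> cliques E ?N" for K
    using that assms finite_subset[of K B] by (subst card_insert_disjoint) (auto simp: cliques_def)
  have "clique_sum E B x = clique_sum E (B - {v}) x + (\<Sum>K\<in>?C. x ^ card K)"
    unfolding clique_sum_def split
    by (rule sum.union_disjoint) (use assms in \<open>auto simp: finite_cliques cliques_def\<close>)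
  also have "(\<Sum>K\<in>?C. x ^ card K) = x * clique_sum E ?N x"
    unfolding sum.reindex[OF inj] clique_sum_def sum_distrib_left
    by (rule sum.cong) (use card in auto)
  finally show ?thesis .
qed

text \<open>The new cliques are those containing both ends of the added edge. Removing the two ends
  leaves a clique of common neighbours, hence the factor \<open>x\<^sup>2\<close>.\<close>

lemma clique_sum_insert_edge:
  assumes "finite B" "u \<in> B" "v \<in> B" "u \<noteq> v" "{u, v} \<notin> E"
  shows "clique_sum (insert {u, v} E) B x =
    clique_sum E B x + x\<^sup>2 * clique_sum E {w \<in> B - {u, v}. {u, w} \<in> E \<and> {v, w} \<in> E} x"
proof -
  let ?E = "insert {u, v} E"
  let ?N = "{w \<in> B - {u, v}. {u, w} \<in> E \<and> {v, w} \<in> E}"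
  let ?h = "\<lambda>K. insert u (insert v K)"
  have split: "cliques ?E B = cliques E B \<union> ?h ` cliques E ?N" (is "_ = ?A \<union> ?C")
  proof (intro equalityI subsetI)
    fix K assume K: "K \<in> cliques ?E B"
    show "K \<in> ?A \<union> ?C"
    proof (cases "u \<in> K \<and> v \<in> K")
      case True
      then have "K - {u, v} \<in> cliques E ?N" "K = ?h (K - {u, v})"
        using K by (auto simp: cliques_def clique_def doubleton_eq_iff)
      then show ?thesis by blast
    next
      case False
      then have "K \<in> ?A"
        using K by (auto simp: cliques_def clique_def doubleton_eq_iff)
      then show ?thesis ..
    qed
  next
    fix K assume "K \<in> ?A \<union> ?C"
    then show "K \<in> cliques ?E B"
      using assms by (auto simp: cliques_def clique_def insert_commute)
  qed
  have disj: "?A \<inter> ?C = {}"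
    using assms by (auto simp: cliques_def clique_def)
  have inj: "inj_on ?h (cliques E ?N)"
  proof (rule inj_onI)
    fix K L assume "K \<in> cliques E ?N" "L \<in> cliques E ?N" "?h K = ?h L"
    then have "K = ?h K - {u, v}" "L = ?h L - {u, v}"
      by (auto simp: cliques_def)
    then show "K = L" using \<open>?h K = ?h L\<close> by metis
  qed
  have card: "card (?h K) = Suc (Suc (card K))" if "K \<in> cliques E ?N" for K
  proof -
    have "finite K" "u \<notin> K" "v \<notin> K"
      using that assms finite_subset[of K B] by (auto simp: cliques_def)
    then show ?thesis using assms(4) by simp
  qed
  have "clique_sum ?E B x = clique_sum E B x + (\<Sum>K\<in>?C. x ^ card K)"
    unfolding clique_sum_def split
    by (rule sum.union_disjoint) (use assms disj in \<open>auto simp: finite_cliques\<close>)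
  also have "(\<Sum>K\<in>?C. x ^ card K) = x\<^sup>2 * clique_sum E ?N x"
    unfolding sum.reindex[OF inj] clique_sum_def sum_distrib_left
    by (rule sum.cong) (use card in \<open>auto simp: power2_eq_square\<close>)
  finally show ?thesis .
qed

lemma clique_sum_bij_betw:
  assumes bij: "bij_betw f S B"
    and edges: "\<And>u v. u \<in> S \<Longrightarrow> v \<in> S \<Longrightarrow> u \<noteq> v \<Longrightarrow> {u, v} \<in> E \<longleftrightarrow> {f u, f v} \<in> F"
  shows "clique_sum F B x = clique_sum E S x"
proof -
  have inj: "inj_on f S" and img: "f ` S = B"
    using bij by (auto simp: bij_betw_def)
  have clique: "clique (f ` K) F \<longleftrightarrow> clique K E" if "K \<subseteq> S" for K
    using that edges inj by (auto simp: clique_def inj_on_eq_iff subset_iff)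
  have "cliques F B = image f ` cliques E S"
    unfolding img[symmetric] by (auto simp: cliques_def clique subset_image_iff)
  moreover have "inj_on (image f) (cliques E S)"
    by (rule inj_on_subset[OF inj_on_image_Pow[OF inj]]) (auto simp: cliques_def)
  moreover have "card (f ` K) = card K" if "K \<in> cliques E S" for K
    using that by (intro card_image inj_on_subset[OF inj]) (auto simp: cliques_def)
  ultimately show ?thesis
    by (simp add: clique_sum_def sum.reindex)
qed

section \<open>Positivity on an interval ending at 0\<close>

lemma clique_sum_nonpos_imp_root:
  assumes "finite B" "x \<le> 0" "clique_sum E B x \<le> 0"
  obtains y where "x \<le> y" "y < 0" "clique_sum E B y = 0"
proof -
  \<comment> \<open>The value at 0 is 1, the contribution of the empty clique, so the sign changes
    on [x, 0].\<close>
  obtain y where y: "x \<le> y" "y \<le> 0" "clique_sum E B y = 0"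
    using IVT'[of "clique_sum E B" x 0 0] assms
    by (auto simp: clique_sum_0 continuous_on_clique_sum)
  moreover have "y \<noteq> 0"
    using y(3) clique_sum_0[OF assms(1)] by auto
  ultimately show ?thesis using that[of y] by simp
qed

text \<open>By induction on the size of \<open>B\<close> it suffices to delete one vertex outside
  \<open>S\<close>. The induction hypothesis is used twice: to descend from \<open>B - {v}\<close>
  to \<open>S\<close>, and before that to control the neighbourhood of \<open>v\<close> inside
  \<open>B - {v}\<close>.\<close>

lemma clique_sum_pos_subset:
  assumes "finite B" "S \<subseteq> B" "\<And>y. x \<le> y \<Longrightarrow> y \<le> 0 \<Longrightarrow> clique_sum E B y > 0"
    and "x \<le> y" "y \<le> 0"
  shows "clique_sum E S y > 0"
  using assms
proof (induction "card B" arbitrary: B S x y rule: less_induct)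
  case less
  show ?case
  proof (cases "S = B")
    case False
    then obtain v where v: "v \<in> B" "v \<notin> S" using less.prems by blast
    let ?B = "B - {v}"
    let ?N = "{w \<in> ?B. {v, w} \<in> E}"
    have fin: "finite ?B" "finite ?N" and smaller: "card ?B < card B"
      using less.prems(1) v(1) by (auto intro!: psubset_card_mono simp del: card_Diff_singleton card_Diff_insert)
    have pos: "clique_sum E ?B z > 0" if z: "x \<le> z" "z \<le> 0" for z
    proof (rule ccontr)
      assume "\<not> clique_sum E ?B z > 0"
      then obtain q where q: "z \<le> q" "q < 0" "clique_sum E ?B q = 0"
        using clique_sum_nonpos_imp_root[OF fin(1) z(2)] by (metis not_less)
      \<comment> \<open>The largest root is chosen so that \<open>?B\<close> is positive on (r, 0],
        which the induction hypothesis passes on to \<open>?N\<close>.\<close>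
      define r where "r = Max (neg_roots E ?B)"
      have "q \<in> neg_roots E ?B"
        using q by (simp add: neg_roots_def poly_clique_poly[OF fin(1)])
      then have "r \<in> neg_roots E ?B" "q \<le> r"
        unfolding r_def using finite_neg_roots[OF fin(1), of E] by (auto intro: Max_in)
      then have r: "x \<le> r" "r < 0" "clique_sum E ?B r = 0"
        using q(1) z(1) by (auto simp: neg_roots_def poly_clique_poly[OF fin(1)])
      have last_root: "clique_sum E ?B s > 0" if s: "r < s" "s \<le> 0" for s
      proof (rule ccontr)
        assume "\<not> clique_sum E ?B s > 0"
        then obtain p where p: "s \<le> p" "p < 0" "clique_sum E ?B p = 0"
          using clique_sum_nonpos_imp_root[OF fin(1) s(2)] by (metis not_less)
        then have "p \<le> r"
          unfolding r_def using finite_neg_roots[OF fin(1), of E]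
          by (intro Max_ge) (auto simp: neg_roots_def poly_clique_poly[OF fin(1)])
        then show False using p(1) s(1) by simp
      qed
      have N_pos: "clique_sum E ?N s > 0" if s: "r < s" "s \<le> 0" for s
      \<comment> \<open>The interval starts at \<open>s\<close>, not at \<open>r\<close>, because
        \<open>?B\<close> vanishes at \<open>r\<close>.\<close>
      proof (rule less.hyps[OF smaller fin(1)])
        show "clique_sum E ?B w > 0" if "s \<le> w" "w \<le> 0" for w
          using last_root that s(1) by simp
      qed (use s in auto)
      \<comment> \<open>A negative value at \<open>r\<close> would force a root of \<open>?N\<close>
        strictly between \<open>r\<close> and 0.\<close>
      have "clique_sum E ?N r \<ge> 0"
      proof (rule ccontr)
        assume neg: "\<not> clique_sum E ?N r \<ge> 0"
        then have "clique_sum E ?N r \<le> 0" by linarith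
        from clique_sum_nonpos_imp_root[OF fin(2) less_imp_le[OF r(2)] this]
        obtain p where p: "r \<le> p" "p < 0" "clique_sum E ?N p = 0" .
        have "r \<noteq> p" using p(3) neg by auto
        with p(1) have "r < p" by linarith
        then show False using N_pos[of p] p by simp
      qed
      \<comment> \<open>At \<open>r\<close> the recurrence reduces to
        \<open>r * clique_sum E ?N r\<close> with \<open>r\<close> negative.\<close>
      then have "clique_sum E B r \<le> 0"
        using clique_sum_remove_vertex[OF less.prems(1) v(1), of E r] r
        by (simp add: mult_nonpos_nonneg)
      then show False using less.prems(3)[of r] r by simp
    qed
    show ?thesis
      using less.hyps[OF smaller fin(1) _ pos, of S] v less.prems by blast
  qed (use less.prems in blast)
qed

text \<open>The elements of \<open>D\<close> are added one at a time. The term gained from a new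
  edge is a square times the sum over the common neighbours, which is positive by
  \<open>clique_sum_pos_subset\<close> for the graph built so far; this is why positivity is carried
  along on all of [x, 0].\<close>

lemma clique_sum_pos_superset_edges:
  assumes "finite D" "finite B"
    and pos: "\<And>y. x \<le> y \<Longrightarrow> y \<le> 0 \<Longrightarrow> clique_sum E B y > 0"
    and "x \<le> y" "y \<le> 0"
  shows "clique_sum (D \<union> E) B y > 0"
  using assms(1,4,5)
proof (induction D arbitrary: y rule: finite_induct)
  case (insert e D)
  let ?E = "D \<union> E"
  have IH: "clique_sum ?E B z > 0" if "x \<le> z" "z \<le> 0" for z
    using insert.IH that .
  show ?case
  proof (cases "e \<notin> ?E \<and> (\<exists>u\<in>B. \<exists>v\<in>B. u \<noteq> v \<and> e = {u, v})")
    case True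
    then obtain u v where uv: "u \<in> B" "v \<in> B" "u \<noteq> v" "e = {u, v}" "{u, v} \<notin> ?E"
      by blast
    let ?N = "{w \<in> B - {u, v}. {u, w} \<in> ?E \<and> {v, w} \<in> ?E}"
    have "clique_sum ?E ?N y > 0"
      by (rule clique_sum_pos_subset[OF assms(2) _ IH insert.prems]) auto
    then have "0 \<le> y\<^sup>2 * clique_sum ?E ?N y" by simp
    then show ?thesis
      using clique_sum_insert_edge[OF assms(2) uv(1-3,5), of y] IH[OF insert.prems] uv(4)
      by simp
  next
    case False
    \<comment> \<open>If \<open>e\<close> is already present or does not join two distinct vertices
      of \<open>B\<close>, the cliques inside \<open>B\<close> stay the same.\<close>
    then have "{u, v} \<in> insert e ?E \<longleftrightarrow> {u, v} \<in> ?E" if "u \<in> B" "v \<in> B" "u \<noteq> v" for u v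
      using that by blast
    then have "clique K (insert e ?E) \<longleftrightarrow> clique K ?E" if "K \<subseteq> B" for K
      using that unfolding clique_def by (meson subsetD)
    then have "cliques (insert e ?E) B = cliques ?E B"
      unfolding cliques_def by blast
    then show ?thesis
      using IH[OF insert.prems] by (simp add: clique_sum_def)
  qed
qed (use pos in simp)

section \<open>Transfer along a surjective homomorphism\<close>

lemma clique_sum_pos_surj_hom:
  assumes "finite B" "f ` B = C"
    and hom: "\<And>u v. u \<in> B \<Longrightarrow> v \<in> B \<Longrightarrow> {u, v} \<in> E \<Longrightarrow> {f u, f v} \<in> F"
    and pos: "\<And>y. x \<le> y \<Longrightarrow> y \<le> 0 \<Longrightarrow> clique_sum E B y > 0"
    and "x \<le> 0"
  shows "clique_sum F C x > 0"
proof -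
  obtain S where S: "S \<subseteq> B" "bij_betw f S C"
    using assms(2) subset_image_inj[of C f B] by (auto simp: bij_betw_def)
  have "finite S" using S(1) assms(1) finite_subset by blast
  \<comment> \<open>\<open>S\<close> holds one preimage of each vertex of \<open>C\<close>, and
    \<open>?D\<close> pulls \<open>F\<close> back to it. By \<open>hom\<close> the edges of
    \<open>E\<close> within \<open>S\<close> already lie in \<open>?D\<close>, so \<open>f\<close>
    is an isomorphism from \<open>S\<close> with \<open>?D \<union> E\<close> onto \<open>C\<close>
    with \<open>F\<close>.\<close>
  let ?D = "{{u, v} | u v. u \<in> S \<and> v \<in> S \<and> {f u, f v} \<in> F}"
  have "?D \<subseteq> Pow S" by auto
  then have "finite ?D"
    using \<open>finite S\<close> by (meson finite_Pow_iff finite_subset)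
  have "clique_sum E S y > 0" if "x \<le> y" "y \<le> 0" for y
    using clique_sum_pos_subset[OF assms(1) S(1) pos that] .
  then have "clique_sum (?D \<union> E) S x > 0"
    by (rule clique_sum_pos_superset_edges[OF \<open>finite ?D\<close> \<open>finite S\<close>]) (use assms in auto)
  moreover have "{u, v} \<in> ?D \<union> E \<longleftrightarrow> {f u, f v} \<in> F" if "u \<in> S" "v \<in> S" for u v
    using that hom[of u v] S(1) by (auto simp: doubleton_eq_iff insert_commute)
  ultimately show ?thesis
    by (subst clique_sum_bij_betw[OF S(2), of "?D \<union> E" F]) auto
qed

theorem theorem4p3:
  fixes V\<^sub>G B\<^sub>G :: "'a set" and E\<^sub>G :: "'a set set"
    and V\<^sub>H B\<^sub>H :: "'b set" and E\<^sub>H :: "'b set set"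
    and f :: "'a \<Rightarrow> 'b"
  assumes "fin_simple_graph V\<^sub>G E\<^sub>G" and "fin_simple_graph V\<^sub>H E\<^sub>H"
    and "B\<^sub>G \<subseteq> V\<^sub>G" and "B\<^sub>H \<subseteq> V\<^sub>H"
    and "surj_graph_hom V\<^sub>G E\<^sub>G V\<^sub>H E\<^sub>H f"
    and "f ` B\<^sub>G = B\<^sub>H"
  shows "zeta E\<^sub>G B\<^sub>G \<ge> zeta E\<^sub>H B\<^sub>H"
proof (cases "neg_roots E\<^sub>H B\<^sub>H = {}")
  case False
  have fin: "finite B\<^sub>G" "finite B\<^sub>H"
    using assms fin_simple_graph.finite_verts finite_subset by metis+
  define z where "z = Max (neg_roots E\<^sub>H B\<^sub>H)"
  have "z \<in> neg_roots E\<^sub>H B\<^sub>H"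
    unfolding z_def using finite_neg_roots[OF fin(2)] False by (rule Max_in)
  then have z: "z < 0" "clique_sum E\<^sub>H B\<^sub>H z = 0"
    by (auto simp: neg_roots_def poly_clique_poly[OF fin(2)])
  have hom: "{f u, f v} \<in> E\<^sub>H" if "u \<in> B\<^sub>G" "v \<in> B\<^sub>G" "{u, v} \<in> E\<^sub>G" for u v
    using that assms(3,5) by (auto simp: surj_graph_hom_def graph_hom_def)
  \<comment> \<open>Otherwise positivity on [z, 0] would carry over to the second graph, which has
    the root \<open>z\<close>.\<close>
  have "\<exists>y. z \<le> y \<and> y \<le> 0 \<and> clique_sum E\<^sub>G B\<^sub>G y \<le> 0"
  proof (rule ccontr)
    assume "\<not> ?thesis"
    then have "clique_sum E\<^sub>G B\<^sub>G y > 0" if "z \<le> y" "y \<le> 0" for y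
      using that not_less by blast
    then have "clique_sum E\<^sub>H B\<^sub>H z > 0"
      using clique_sum_pos_surj_hom[OF fin(1) assms(6) hom, where x = z] z(1) by simp
    then show False using z(2) by simp
  qed
  then obtain y where y: "z \<le> y" "y \<le> 0" "clique_sum E\<^sub>G B\<^sub>G y \<le> 0"
    by blast
  then obtain r where r: "y \<le> r" "r < 0" "clique_sum E\<^sub>G B\<^sub>G r = 0"
    using clique_sum_nonpos_imp_root[OF fin(1)] by metis
  then have "r \<in> neg_roots E\<^sub>G B\<^sub>G"
    by (simp add: neg_roots_def poly_clique_poly[OF fin(1)])
  then have "neg_roots E\<^sub>G B\<^sub>G \<noteq> {}" "r \<le> Max (neg_roots E\<^sub>G B\<^sub>G)"
    using finite_neg_roots[OF fin(1)] by auto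
  then show ?thesis
    using False y(1) r(1) by (simp add: zeta_def z_def)
\<comment> \<open>Without negative roots on the right, the default value -\<infinity> makes the
  inequality trivial.\<close>
qed (simp add: zeta_def)

end
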